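(* Let $G$ be a DAG task with $vol(G)>0$, let $(\lambda_i)_0^{\bar k}$ be the generalized path list returned by the greedy path-removal algorithm (described in the context) on $G$, and put $C=vol(G)$, $L_i=len(\lambda_i)$ for $i\in[0,\bar k]$, and $L=L_0=len(G)$. Let $D$ (relative deadline) and $T$ (period) satisfy $C\ge D\ge L$ and $D\le T$. Then the parallel real-time task $(\langle C,(L_i)_0^{\bar k}\rangle,D,T)$ is schedulable on $m$ cores, where $$m=\min_{j\in[0,\bar k]}\{m(j)\},\qquad m(j)=\begin{cases}\left\lceil \dfrac{C-\sum_{i=0}^{j}L_i}{D-L}\right\rceil+j & \text{if } j<\bar k \text{ and } D>L,\\[2mm] \bar k+1 & \text{if } j=\bar k,\end{cases}$$ the minimum being taken over those $j$ for which $m(j)$ is defined.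
   Context: **DAG task.** $G=(V,E)$ is a finite directed acyclic graph with exactly one source $v_{src}$ and exactly one sink $v_{snk}$. Each vertex $v$ has a worst-case execution time (WCET) $c(v)$, a nonnegative integer. $pre(v)=\{u:(u,v)\in E\}$. For a set or sequence of vertices, its length/volume is the sum of $c(v)$ over its vertices; $vol(G)=\sum_{v\in V}c(v)$. A complete path is a path from $v_{src}$ to $v_{snk}$; "the longest path" is a complete path of maximal length, and its length is $len(G)$. **Greedy path-removal algorithm.** Start with $G'=G$, $i=0$. While $vol(G')\ne 0$: let $\lambda_i$ be the longest path of $G'$ (lengths computed with the WCETs of $G'$); delete from $\lambda_i$ all vertices whose WCET in $G'$ is $0$; replace $G'$ by the residue graph, i.e. the graph with the same vertices and edges in which the WCETs of vertices of $\lambda_i$ are set to $0$ and other WCETs are unchanged; increment $i$. The output is $(\lambda_0,\dots,\lambda_{\bar k})$, where $\bar k+1$ is the number of iterations. The output consists of pairwise disjoint generalized paths (sequences of vertices in which consecutive vertices are connected by a path of $G$). **Execution.** Time is discrete; a time unit is $\delta=[t,t+1]$ with $t\in\mathbb{N}$, $s(\delta)=t$, $f(\delta)=t+1$. In an execution sequence of $G$ on $m$ identical cores, each vertex $v$ has an execution time $e(v)$, an integer with $0\le e(v)\le c(v)$, and executes in exactly $e(v)$ time units (preemption and migration are allowed); in each time unit a vertex executes on at most one core and a core executes at most one vertex (a core executing a vertex is busy). $s(v)$ and $f(v)$ are the start of the first and the finish of the last time unit in which $v$ executes; if $e(v)=0$ then $v$ has a time point $s(v)=f(v)\in\mathbb{N}$.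 Precedence: $s(v)\ge f(u)$ for all $(u,v)\in E$; $s(v_{src})=0$. The scheduling is work-conserving: for every vertex $v$ and time unit $\delta$ with $f(u)\le s(\delta)$ for all $u\in pre(v)$ and $f(\delta)\le f(v)$, either $v$ executes in $\delta$ or all $m$ cores are busy in $\delta$. The response time is $f(v_{snk})$. **Schedulable.** The task is schedulable on $m$ cores if, when executed exclusively on $m$ cores, the response time of $G$ is at most $D$ in every execution sequence under work-conserving scheduling. (Since $D\le T$, consecutive jobs then do not overlap.) *)

theory Defs
  imports Complex_Main "Graph_Theory.Pair_Digraph" "Graph_Theory.Vertex_Walk"
begin

section \<open>DAG tasks\<close>

definition pre :: "'a pair_pre_digraph \<Rightarrow> 'a \<Rightarrow> 'a set" where
  "pre G v = {u. (u, v) \<in> parcs G}"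

definition is_source :: "'a pair_pre_digraph \<Rightarrow> 'a \<Rightarrow> bool" where
  "is_source G v \<longleftrightarrow> v \<in> pverts G \<and> (\<nexists>u. (u, v) \<in> parcs G)"

definition is_sink :: "'a pair_pre_digraph \<Rightarrow> 'a \<Rightarrow> bool" where
  "is_sink G v \<longleftrightarrow> v \<in> pverts G \<and> (\<nexists>w. (v, w) \<in> parcs G)"

locale task_dag = pair_fin_digraph G for G :: "'a pair_pre_digraph" +
  assumes acyclic_arcs: "acyclic (parcs G)"
    and unique_source: "\<exists>!v. is_source G v"
    and unique_sink: "\<exists>!v. is_sink G v"

text \<open>Only meaningful under \<^locale>\<open>task_dag\<close>, where the source and the sink are unique.\<close>

definition v_src :: "'a pair_pre_digraph \<Rightarrow> 'a" where
  "v_src G = (THE v. is_source G v)"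

definition v_snk :: "'a pair_pre_digraph \<Rightarrow> 'a" where
  "v_snk G = (THE v. is_sink G v)"

text \<open>The WCETs \<open>c\<close> are kept separate from the graph because the residue graphs differ from
  \<open>G\<close> only in their WCETs.\<close>

definition vol :: "'a pair_pre_digraph \<Rightarrow> ('a \<Rightarrow> nat) \<Rightarrow> nat" where
  "vol G c = (\<Sum>v\<in>pverts G. c v)"

definition seq_len :: "('a \<Rightarrow> nat) \<Rightarrow> 'a list \<Rightarrow> nat" where
  "seq_len c p = (\<Sum>v\<leftarrow>p. c v)"

definition complete_path :: "'a pair_pre_digraph \<Rightarrow> 'a list \<Rightarrow> bool" where
  "complete_path G p \<longleftrightarrow> vpath p (with_proj G) \<and> hd p = v_src G \<and> last p = v_snk G"

definition longest_path :: "'a pair_pre_digraph \<Rightarrow> ('a \<Rightarrow> nat) \<Rightarrow> 'a list \<Rightarrow> bool" where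
  "longest_path G c p \<longleftrightarrow>
     complete_path G p \<and> (\<forall>q. complete_path G q \<longrightarrow> seq_len c q \<le> seq_len c p)"

definition len :: "'a pair_pre_digraph \<Rightarrow> ('a \<Rightarrow> nat) \<Rightarrow> nat" where
  "len G c = Max (seq_len c ` {p. complete_path G p})"


section \<open>Greedy path removal\<close>

definition residue :: "('a \<Rightarrow> nat) \<Rightarrow> 'a set \<Rightarrow> 'a \<Rightarrow> nat" where
  "residue c S = (\<lambda>v. if v \<in> S then 0 else c v)"

text \<open>\<open>greedy_paths G c ls\<close>: the algorithm, run on \<open>G\<close> with WCETs \<open>c\<close>, can return \<open>ls\<close>.
  It is a relation because ties between longest paths may be broken arbitrarily.\<close>

inductive greedy_paths :: "'a pair_pre_digraph \<Rightarrow> ('a \<Rightarrow> nat) \<Rightarrow> 'a list list \<Rightarrow> bool"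
  for G where
  stop: "vol G c = 0 \<Longrightarrow> greedy_paths G c []"
| step: "vol G c \<noteq> 0 \<Longrightarrow> longest_path G c p \<Longrightarrow> l = filter (\<lambda>v. c v \<noteq> 0) p \<Longrightarrow>
         greedy_paths G (residue c (set l)) ls \<Longrightarrow> greedy_paths G c (l # ls)"


section \<open>Execution sequences\<close>

text \<open>\<open>run t p = Some v\<close>: core \<open>p\<close> executes \<open>v\<close> in the time unit \<open>[t, t + 1]\<close>;
  \<open>None\<close> means that the core is idle. The \<open>m\<close> cores are \<open>0, \<dots>, m - 1\<close>.\<close>

definition exec_units :: "nat \<Rightarrow> (nat \<Rightarrow> nat \<Rightarrow> 'a option) \<Rightarrow> 'a \<Rightarrow> nat set" where
  "exec_units m run v = {t. \<exists>p<m. run t p = Some v}"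

locale execution_sequence =
  fixes G :: "'a pair_pre_digraph" and c :: "'a \<Rightarrow> nat" and m :: nat
    and run :: "nat \<Rightarrow> nat \<Rightarrow> 'a option" and e s f :: "'a \<Rightarrow> nat"
  assumes run_verts: "p < m \<Longrightarrow> run t p = Some v \<Longrightarrow> v \<in> pverts G"
    and one_core: "p < m \<Longrightarrow> q < m \<Longrightarrow> run t p = Some v \<Longrightarrow> run t q = Some v \<Longrightarrow> p = q"
    and exec_le_wcet: "v \<in> pverts G \<Longrightarrow> e v \<le> c v"
    and finite_units: "v \<in> pverts G \<Longrightarrow> finite (exec_units m run v)"
    and card_units: "v \<in> pverts G \<Longrightarrow> card (exec_units m run v) = e v"
    and start: "v \<in> pverts G \<Longrightarrow> e v > 0 \<Longrightarrow> s v = Min (exec_units m run v)"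
    and finish: "v \<in> pverts G \<Longrightarrow> e v > 0 \<Longrightarrow> f v = Max (exec_units m run v) + 1"
    and zero_exec: "v \<in> pverts G \<Longrightarrow> e v = 0 \<Longrightarrow> s v = f v"
    and precedence: "(u, v) \<in> parcs G \<Longrightarrow> s v \<ge> f u"
    and start_src: "s (v_src G) = 0"

definition work_conserving ::
  "'a pair_pre_digraph \<Rightarrow> nat \<Rightarrow> (nat \<Rightarrow> nat \<Rightarrow> 'a option) \<Rightarrow> ('a \<Rightarrow> nat) \<Rightarrow> bool" where
  "work_conserving G m run f \<longleftrightarrow>
     (\<forall>v\<in>pverts G. \<forall>t. (\<forall>u\<in>pre G v. f u \<le> t) \<and> t + 1 \<le> f v \<longrightarrow>
        t \<in> exec_units m run v \<or> (\<forall>p<m. run t p \<noteq> None))"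

definition schedulable :: "'a pair_pre_digraph \<Rightarrow> ('a \<Rightarrow> nat) \<Rightarrow> real \<Rightarrow> nat \<Rightarrow> bool" where
  "schedulable G c D m \<longleftrightarrow>
     (\<forall>run e s f. execution_sequence G c m run e s f \<and> work_conserving G m run f \<longrightarrow>
        real (f (v_snk G)) \<le> D)"


section \<open>The number of cores\<close>

text \<open>\<open>m_of C Ls L D j\<close> is \<open>m(j)\<close> for the lengths \<open>Ls = [L_0, \<dots>, L_k]\<close>, and
  \<open>m_dom\<close> is the set of those \<open>j\<close> for which \<open>m(j)\<close> is defined. For \<open>j < k\<close> in that set the
  argument of the ceiling is positive, so that \<^const>\<open>nat\<close> does not truncate.\<close>

definition m_dom :: "nat list \<Rightarrow> nat \<Rightarrow> real \<Rightarrow> nat set" where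
  "m_dom Ls L D = (let k = length Ls - 1 in {j. j < k \<and> D > real L \<or> j = k})"

definition m_of :: "nat \<Rightarrow> nat list \<Rightarrow> nat \<Rightarrow> real \<Rightarrow> nat \<Rightarrow> nat" where
  "m_of C Ls L D j = (let k = length Ls - 1 in
     if j < k then nat \<lceil>(real C - (\<Sum>i=0..j. real (Ls ! i))) / (D - real L)\<rceil> + j
     else k + 1)"

lemma len_first_path:
  assumes "finite (pverts G)" "vol G c > 0" "greedy_paths G c ls"
  shows "seq_len c (ls ! 0) = len G c"
proof -
  obtain p ls' where p: "longest_path G c p" and ls: "ls = filter (\<lambda>v. c v \<noteq> 0) p # ls'"
    using assms(3,2) by (cases rule: greedy_paths.cases) auto
  have "seq_len c (filter (\<lambda>v. c v \<noteq> 0) q) = seq_len c q" for q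
    by (induction q) (auto simp: seq_len_def)
  moreover have "finite {p. complete_path G p}"
    by (rule finite_subset[OF _ finite_subset_distinct[OF assms(1)]])
      (auto simp: complete_path_def vpath_def vwalk_def)
  then have "len G c = seq_len c p"
    unfolding len_def using p by (intro Max_eqI) (auto simp: longest_path_def)
  ultimately show ?thesis using ls by simp
qed

end

theory Submission
  imports Defs
begin

text \<open>Let \<open>H t\<close> be the largest amount of execution that a chain of \<open>G\<close> still receives from time \<open>t\<close>
  on. It falls from at most \<open>L\<close> to \<open>0\<close> in steps of at most one, and work conservation forces a step
  whenever a core is idle. So all \<open>m\<close> cores are busy in the \<open>\<pi>\<close> time units without a step, and
  the response time is at most \<open>L + \<pi>\<close>.

  These units contain \<open>m \<pi>\<close> pieces of execution. Each step unit contributes one more piece, of a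
  vertex \<open>y\<close> beginning a chain that attains \<open>H\<close>. One can select \<open>\<pi>\<close> of these additional pieces
  so that no chain contains more than \<open>\<pi>\<close> of the resulting \<open>(m + 1) \<pi>\<close> pieces (if \<open>\<pi>\<close>
  exceeds \<open>H 0\<close>, one takes all of them instead). Hence \<open>j + 1\<close> chains leave at least
  \<open>(m - j) \<pi>\<close> pieces uncovered, that is, \<open>(m - j) \<pi> \<le> C - (L\<^sub>0 + \<dots> + L\<^sub>j)\<close>, and the choice of
  \<open>m\<close> gives \<open>\<pi> \<le> D - L\<close>.\<close>

section \<open>A counting lemma on time units\<close>

lemma card_Diff_atLeastLessThan:
  fixes t R :: nat
  assumes "t \<le> R"
  shows "card ({..<R} - Z) = card ({..<t} - Z) + card ({t..<R} - Z)"
proof -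
  have "{..<R} - Z = ({..<t} - Z) \<union> ({t..<R} - Z)"
    using assms by auto
  also have "card \<dots> = card ({..<t} - Z) + card ({t..<R} - Z)"
    by (rule card_Un_disjoint) auto
  finally show ?thesis .
qed

text \<open>The time units outside \<open>Z\<close> are chosen by matching brackets: the walk \<open>w\<close> goes up on \<open>Z\<close> and
  down elsewhere, and the down-steps that do not reach a new minimum before \<open>w\<close> attains its final
  value are as many as the up-steps there. From then on, all down-steps are chosen.\<close>

lemma balanced_choice_exists:
  fixes R :: nat and Z :: "nat set"
  assumes Z: "Z \<subseteq> {..<R}" and le: "card Z \<le> card ({..<R} - Z)"
  obtains Q where "Q \<subseteq> {..<R} - Z" "card Z \<le> card Q"
    "\<And>T. \<lbrakk>T \<subseteq> Z \<union> Q;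
           \<And>t. t \<le> R \<Longrightarrow> card (T \<inter> {t..}) \<le> card ({t..<R} - Z);
           \<And>t t\<^sub>0. \<lbrakk>t \<in> T - Z; t\<^sub>0 \<le> t\<rbrakk> \<Longrightarrow> card (T \<inter> {t\<^sub>0..t}) \<le> card ({t\<^sub>0..<Suc t} - Z)\<rbrakk>
           \<Longrightarrow> card T \<le> card Z"
proof -
  define z n where "z t = card (Z \<inter> {..<t})" and "n t = card ({..<t} - Z)" for t
  define w where "w t = int (z t) - int (n t)" for t
  have z_Suc: "z (Suc t) = z t + (if t \<in> Z then 1 else 0)" for t
    by (auto simp: z_def lessThan_Suc Int_insert_right)
  have n_Suc: "n (Suc t) = n t + (if t \<in> Z then 0 else 1)" for t
    by (auto simp: n_def lessThan_Suc insert_Diff_if)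
  have w_Suc: "w (Suc t) = w t + (if t \<in> Z then 1 else -1)" for t
    by (simp add: w_def z_Suc n_Suc)
  have w0: "w 0 = 0"
    by (simp add: w_def z_def n_def)
  have zR: "z R = card Z"
    using Z by (simp add: z_def Int_absorb2)
  have wR: "w R \<le> 0"
    using le zR by (simp add: w_def n_def)
  \<comment> \<open>The first time at or below the final value \<open>w R\<close>. Since
    \<open>w R \<le> w 0\<close> and all steps have size one, \<open>w\<close> equals
    \<open>w R\<close> there.\<close>
  define ts where "ts = (LEAST t. w t \<le> w R)"
  have ts_le: "w ts \<le> w R"
    unfolding ts_def by (rule LeastI) (rule order_refl)
  have ts_R: "ts \<le> R"
    unfolding ts_def by (rule Least_le) (rule order_refl)
  have before: "w R < w t" if "t < ts" for t
    using not_less_Least[OF that[unfolded ts_def]] by simp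
  have w_ts: "w ts = w R"
  proof (cases ts)
    case 0
    then show ?thesis using ts_le w0 wR by simp
  next
    case (Suc t)
    then show ?thesis using before[of t] ts_le w_Suc[of t] by (auto split: if_splits)
  qed
  define Q where "Q = {t \<in> {..<R} - Z. ts \<le> t \<or> (\<exists>t\<^sub>0\<le>t. w t\<^sub>0 < w t)}"
  have tail: "card ({ts..<R} - Z) + n ts = n R"
    using card_Diff_atLeastLessThan[OF ts_R, of Z] by (simp add: n_def)
  \<comment> \<open>From \<open>ts\<close> to \<open>R\<close> the walk has no net change, so up-
    and down-steps are equally many there.\<close>
  have bal: "card ({ts..<R} - Z) + z ts = card Z"
    using tail w_ts zR by (simp add: w_def)
  have Q: "card Z \<le> card Q"
  proof -
    \<comment> \<open>The rejected down-steps start at running minima before \<open>ts\<close>,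
      hence at distinct levels in \<open>{w R<..0}\<close>; so at most \<open>- w R\<close> are
      rejected.\<close>
    define B where "B = {t \<in> {..<ts} - Z. \<forall>t\<^sub>0\<le>t. w t \<le> w t\<^sub>0}"
    have "w ` B \<subseteq> {w R<..0}"
      using before w0 by (fastforce simp: B_def)
    moreover have "w u < w t" if "t \<in> B" "u \<in> B" "t < u" for t u
    proof -
      have "w u \<le> w (Suc t)" using that by (auto simp: B_def)
      then show ?thesis using that w_Suc[of t] by (auto simp: B_def)
    qed
    then have "inj_on w B"
      by (metis linorder_inj_onI less_irrefl linear)
    ultimately have "card B \<le> card {w R<..0}"
      by (intro card_inj_on_le) auto
    then have B: "int (card B) \<le> - w R"
      using wR by simp
    have "{..<R} - Z = Q \<union> B"
      using ts_R by (auto simp: Q_def B_def not_le not_less)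
    then have "n R \<le> card Q + card B"
      unfolding n_def by (metis card_Un_le)
    then show ?thesis
      using B zR by (simp add: w_def)
  qed
  have chosen: "card T \<le> card Z"
    if T: "T \<subseteq> Z \<union> Q"
      and late: "\<And>t. t \<le> R \<Longrightarrow> card (T \<inter> {t..}) \<le> card ({t..<R} - Z)"
      and window: "\<And>t t\<^sub>0. \<lbrakk>t \<in> T - Z; t\<^sub>0 \<le> t\<rbrakk> \<Longrightarrow>
             card (T \<inter> {t\<^sub>0..t}) \<le> card ({t\<^sub>0..<Suc t} - Z)" for T
  proof -
    have "t \<le> ts \<Longrightarrow> card (T \<inter> {..<t}) \<le> z t" for t
    proof (induction t rule: less_induct)
      case (less t)
      show ?case
      proof (cases t)
        case 0
        then show ?thesis by simp
      next
        case t: (Suc u)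
        have IH: "card (T \<inter> {..<u}) \<le> z u"
          using less t by simp
        consider "u \<notin> T" | "u \<in> Z" | "u \<in> T - Z" by blast
        then show ?thesis
        proof cases
          case 1
          then have "T \<inter> {..<t} = T \<inter> {..<u}"
            by (auto simp: t less_Suc_eq)
          then show ?thesis using IH z_Suc[of u] t by simp
        next
          case 2
          have "card (T \<inter> {..<t}) \<le> card (insert u (T \<inter> {..<u}))"
            by (intro card_mono) (auto simp: t less_Suc_eq)
          also have "\<dots> \<le> Suc (card (T \<inter> {..<u}))"
            by (rule card_insert_le_m1) auto
          finally show ?thesis using IH z_Suc[of u] t 2 by simp
        next
          case 3
          then have "u \<in> Q" using T by auto
          \<comment> \<open>The walk was lower at \<open>t0\<close>: this gap of at least one pays
            for the down-step \<open>u\<close>, which the window bound counts as well.\<close>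
          then obtain t0 where t0: "t0 \<le> u" "w t0 < w u"
            using less.prems t by (auto simp: Q_def)
          have "T \<inter> {..<t} = (T \<inter> {..<t0}) \<union> (T \<inter> {t0..u})"
            using t0 by (auto simp: t)
          then have "card (T \<inter> {..<t}) \<le> card (T \<inter> {..<t0}) + card (T \<inter> {t0..u})"
            by (metis card_Un_le)
          also have "\<dots> \<le> z t0 + card ({t0..<t} - Z)"
            using less.IH[of t0] less.prems t0 window[OF 3 t0(1)] t by (intro add_mono) auto
          also have "\<dots> + n t0 = z t0 + n t"
            using card_Diff_atLeastLessThan[of t0 t Z] t0 t by (simp add: n_def)
          finally show ?thesis
            using t0 3 z_Suc[of u] n_Suc[of u] t by (simp add: w_def)
        qed
      qed
    qed
    from this[of ts] have early: "card (T \<inter> {..<ts}) \<le> z ts" by simp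
    have "T = (T \<inter> {..<ts}) \<union> (T \<inter> {ts..})" by auto
    then have "card T \<le> card (T \<inter> {..<ts}) + card (T \<inter> {ts..})"
      by (metis card_Un_le)
    then show ?thesis
      using early late[OF ts_R] bal by linarith
  qed
  have "Q \<subseteq> {..<R} - Z"
    by (auto simp: Q_def)
  then show ?thesis
    using Q chosen by (rule that)
qed

section \<open>Chains of vertices\<close>

context task_dag
begin

text \<open>Sets of pairwise comparable vertices are used instead of paths: they include the
  generalized paths of the algorithm and are closed under subsets.\<close>

definition dag_chain :: "'a set \<Rightarrow> bool" where
  "dag_chain S \<longleftrightarrow> S \<subseteq> pverts G \<and>
     (\<forall>u\<in>S. \<forall>v\<in>S. (u, v) \<in> (parcs G)\<^sup>* \<or> (v, u) \<in> (parcs G)\<^sup>*)"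

lemma dag_chain_empty [simp]: "dag_chain {}"
  by (simp add: dag_chain_def)

lemma dag_chain_subset: "dag_chain S \<Longrightarrow> T \<subseteq> S \<Longrightarrow> dag_chain T"
  by (auto simp: dag_chain_def subset_iff)

lemma finite_dag_chain: "dag_chain S \<Longrightarrow> finite S"
  using finite_subset[OF _ pair_finite_verts] by (auto simp: dag_chain_def)

lemma arc_verts: "(u, v) \<in> parcs G \<Longrightarrow> u \<in> pverts G \<and> v \<in> pverts G"
  using arc_fst_in_verts arc_snd_in_verts by fastforce

lemma reach_verts: "(u, v) \<in> (parcs G)\<^sup>* \<Longrightarrow> v \<in> pverts G \<Longrightarrow> u \<in> pverts G"
  by (induction rule: converse_rtrancl_induct) (auto dest: arc_verts)

lemma wf_parcs: "wf (parcs G)"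
  using pair_finite_arcs acyclic_arcs by (rule finite_acyclic_wf)

lemma wf_converse_parcs: "wf ((parcs G)\<inverse>)"
  using pair_finite_arcs acyclic_arcs by (rule finite_acyclic_wf_converse)

lemma v_src: "is_source G (v_src G)"
  unfolding v_src_def using unique_source by (rule theI')

lemma v_snk: "is_sink G (v_snk G)"
  unfolding v_snk_def using unique_sink by (rule theI')

lemma v_src_reach: "v \<in> pverts G \<Longrightarrow> (v_src G, v) \<in> (parcs G)\<^sup>*"
proof (induction v rule: wf_induct_rule[OF wf_parcs])
  case (1 v)
  show ?case
  proof (cases "is_source G v")
    case True
    then show ?thesis using unique_source v_src by auto
  next
    case False
    then obtain u where "(u, v) \<in> parcs G" using 1 by (auto simp: is_source_def)
    then show ?thesis using 1 arc_verts by (meson rtrancl.rtrancl_into_rtrancl)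
  qed
qed

lemma reach_v_snk: "v \<in> pverts G \<Longrightarrow> (v, v_snk G) \<in> (parcs G)\<^sup>*"
proof (induction v rule: wf_induct_rule[OF wf_converse_parcs])
  case (1 v)
  show ?case
  proof (cases "is_sink G v")
    case True
    then show ?thesis using unique_sink v_snk by auto
  next
    case False
    then obtain u where "(v, u) \<in> parcs G" using 1 by (auto simp: is_sink_def)
    then show ?thesis using 1 arc_verts by (meson converse_iff converse_rtrancl_into_rtrancl)
  qed
qed

lemma dag_chain_least:
  assumes "dag_chain S" "S \<noteq> {}"
  obtains w where "w \<in> S" "\<And>x. x \<in> S \<Longrightarrow> (w, x) \<in> (parcs G)\<^sup>*"
proof -
  obtain w where w: "w \<in> S" "\<And>y. (y, w) \<in> (parcs G)\<^sup>+ \<Longrightarrow> y \<notin> S"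
    using assms(2) wfE_min[OF wf_trancl[OF wf_parcs]] by (metis ex_in_conv)
  then show ?thesis
    using assms(1) by (intro that) (auto simp: dag_chain_def rtrancl_eq_or_trancl)
qed

lemma dag_chain_greatest:
  assumes "dag_chain S" "S \<noteq> {}"
  obtains w where "w \<in> S" "\<And>x. x \<in> S \<Longrightarrow> (x, w) \<in> (parcs G)\<^sup>*"
proof -
  obtain w where w: "w \<in> S" "\<And>y. (w, y) \<in> (parcs G)\<^sup>+ \<Longrightarrow> y \<notin> S"
    using assms(2) wfE_min[OF wf_trancl[OF wf_converse_parcs]]
    by (metis ex_in_conv converse_iff trancl_converse)
  then show ?thesis
    using assms(1) by (intro that) (auto simp: dag_chain_def rtrancl_eq_or_trancl)
qed

section \<open>Walks and chains\<close>

lemma vwalk_hd_reach: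
  "vwalk p (with_proj G) \<Longrightarrow> x \<in> set p \<Longrightarrow> (hd p, x) \<in> (parcs G)\<^sup>*"
  by (induction arbitrary: x rule: vwalk_induct)
    (auto intro: converse_rtrancl_into_rtrancl)

lemma vwalk_dag_chain:
  assumes "vwalk p (with_proj G)"
  shows "dag_chain (set p) \<and> distinct p"
  using assms
proof (induction p rule: list.induct)
  case (Cons u p)
  show ?case
  proof (cases "p = []")
    case True
    then show ?thesis using Cons.prems by (auto simp: dag_chain_def vwalk_def)
  next
    case False
    then have p: "vwalk p (with_proj G)" and arc: "(u, hd p) \<in> parcs G"
      using Cons.prems by (auto elim!: vwalk_consE)
    then have reach: "(u, x) \<in> (parcs G)\<^sup>+" if "x \<in> set p" for x
      using vwalk_hd_reach that by (meson rtrancl_into_trancl2)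
    then have "u \<notin> set p"
      using acyclic_arcs by (auto simp: acyclic_def)
    then show ?thesis
      using Cons.IH[OF p] reach arc_verts[OF arc]
      by (auto simp: dag_chain_def dest: trancl_into_rtrancl)
  qed
qed simp

lemma reach_imp_vwalk:
  assumes "(u, v) \<in> (parcs G)\<^sup>*" "v \<in> pverts G"
  obtains p where "vwalk p (with_proj G)" "hd p = u" "last p = v"
proof -
  have "\<exists>p. vwalk p (with_proj G) \<and> hd p = u \<and> last p = v"
    using assms
  proof (induction rule: converse_rtrancl_induct)
    case base
    then show ?case by (intro exI[of _ "[v]"]) (auto simp: vwalk_def)
  next
    case (step u w)
    then obtain p where "vwalk p (with_proj G)" "hd p = w" "last p = v" by blast
    then show ?case
      using step(1) arc_verts[OF step(1)]
      by (intro exI[of _ "u # p"]) (auto intro: vwalk_consI simp: vwalk_def)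
  qed
  then show ?thesis using that by blast
qed

text \<open>Induction from the top: a walk through the rest of \<open>S\<close> ends in the greatest
  element \<open>w\<close> of \<open>S\<close>, and a walk from \<open>w\<close> to \<open>v\<close>
  continues it.\<close>

lemma dag_chain_vwalk:
  assumes "dag_chain S" "v \<in> pverts G" "\<And>x. x \<in> S \<Longrightarrow> (x, v) \<in> (parcs G)\<^sup>*"
  shows "\<exists>p. vwalk p (with_proj G) \<and> hd p = v_src G \<and> last p = v \<and> S \<subseteq> set p"
  using assms
proof (induction "card S" arbitrary: S v)
  case 0
  then have "S = {}" using finite_dag_chain by auto
  then show ?case using v_src_reach[OF 0(3)] 0(3) by (metis empty_subsetI reach_imp_vwalk)
next
  case (Suc n)
  then obtain w where w: "w \<in> S" "\<And>x. x \<in> S \<Longrightarrow> (x, w) \<in> (parcs G)\<^sup>*"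
    using dag_chain_greatest by (metis card.empty nat.distinct(1))
  have "w \<in> pverts G" using Suc.prems w by (auto simp: dag_chain_def)
  moreover have "n = card (S - {w})"
    using Suc(2) w finite_dag_chain[OF Suc.prems(1)] by simp
  moreover have "dag_chain (S - {w})"
    using Suc.prems(1) by (rule dag_chain_subset) auto
  ultimately obtain p where p: "vwalk p (with_proj G)" "hd p = v_src G" "last p = w"
      "S - {w} \<subseteq> set p"
    using Suc(1)[of "S - {w}" w] w(2) by blast
  obtain q where q: "vwalk q (with_proj G)" "hd q = w" "last q = v"
    using reach_imp_vwalk Suc.prems(2,3) w(1) by metis
  have "p \<noteq> []" "q \<noteq> []" using p q by auto
  \<comment> \<open>\<open>q\<close> starts in \<open>w\<close>, where \<open>p\<close> ends; taking
    \<open>tl q\<close> avoids repeating \<open>w\<close>.\<close>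
  have "vwalk (p @ tl q) (with_proj G)"
  proof (cases "tl q = []")
    case False
    with q have "(w, hd (tl q)) \<in> parcs G" "vwalk (tl q) (with_proj G)"
      by (metis \<open>q \<noteq> []\<close> list.collapse vwalk_consE with_proj_simps(3))+
    then show ?thesis using p False \<open>p \<noteq> []\<close> by (auto simp: vwalk_def vwalk_arcs_append)
  qed (use p in simp)
  moreover have "last (p @ tl q) = v"
    using p q by (metis \<open>q \<noteq> []\<close> last_append last_ConsL last_tl list.collapse)
  moreover have "w \<in> set p" using p(3) \<open>p \<noteq> []\<close> by auto
  ultimately show ?case using p \<open>p \<noteq> []\<close> by (intro exI[of _ "p @ tl q"]) auto
qed

lemma seq_len_distinct: "distinct p \<Longrightarrow> seq_len c p = (\<Sum>v\<in>set p. c v)"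
  by (simp add: seq_len_def sum_list_distinct_conv_sum_set)

lemma complete_path_dag_chain: "complete_path G p \<Longrightarrow> dag_chain (set p)"
  using vwalk_dag_chain by (auto simp: complete_path_def vpath_def)

lemma finite_complete_paths: "finite {p. complete_path G p}"
  by (rule finite_subset[OF _ finite_subset_distinct[OF pair_finite_verts]])
    (auto simp: complete_path_def vpath_def vwalk_def)

text \<open>Every chain lies on a complete path, and WCETs are nonnegative.\<close>

lemma dag_chain_sum_le_len:
  assumes "dag_chain S"
  shows "(\<Sum>v\<in>S. c v) \<le> len G c"
proof -
  obtain p where p: "vwalk p (with_proj G)" "hd p = v_src G" "last p = v_snk G" "S \<subseteq> set p"
    using dag_chain_vwalk[OF assms, of "v_snk G"] v_snk reach_v_snk assms
    by (auto simp: is_sink_def dag_chain_def)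
  then have "distinct p" using vwalk_dag_chain by blast
  then have "complete_path G p" using p by (auto simp: complete_path_def)
  then have "seq_len c p \<le> len G c"
    unfolding len_def using finite_complete_paths by (intro Max_ge) auto
  moreover have "(\<Sum>v\<in>S. c v) \<le> (\<Sum>v\<in>set p. c v)"
    using p(4) by (intro sum_mono2) auto
  ultimately show ?thesis using \<open>distinct p\<close> by (simp add: seq_len_distinct)
qed

end

section \<open>Executions\<close>

locale dag_execution = task_dag G + execution_sequence G c m run e s f
  for G :: "'a pair_pre_digraph" and c m run e s f +
  assumes work_cons: "work_conserving G m run f"
begin

abbreviation units :: "'a \<Rightarrow> nat set" where
  "units \<equiv> exec_units m run"

definition occ :: "'a set \<Rightarrow> nat set" where
  "occ S = (\<Union>v\<in>S. units v)"

definition resp :: nat where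
  "resp = f (v_snk G)"

text \<open>\<open>height\<close> is \<open>H\<close> above; it refers to the actual execution times \<open>e\<close>, so that \<open>height 0\<close> may be
  less than the length of the longest path.\<close>

definition height :: "nat \<Rightarrow> nat" where
  "height t = Max ((\<lambda>S. card (occ S \<inter> {t..})) ` {S. dag_chain S})"

text \<open>\<open>card stalled\<close> is the \<pi> of the overview.\<close>

definition stalled :: "nat set" where
  "stalled = {t \<in> {..<resp}. height (Suc t) = height t}"

section \<open>Order of execution along the arcs\<close>

lemma units_empty: "v \<in> pverts G \<Longrightarrow> e v = 0 \<Longrightarrow> units v = {}"
  using finite_units card_units by fastforce

lemma units_less_f: "v \<in> pverts G \<Longrightarrow> t \<in> units v \<Longrightarrow> t < f v"
  using finish[of v] finite_units[of v] units_empty[of v]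
  by (cases "e v = 0") (auto simp: less_Suc_eq_le)

lemma s_le_units: "v \<in> pverts G \<Longrightarrow> t \<in> units v \<Longrightarrow> s v \<le> t"
  using start[of v] finite_units[of v] units_empty[of v]
  by (cases "e v = 0") auto

lemma s_le_f: "v \<in> pverts G \<Longrightarrow> s v \<le> f v"
proof (cases "e v = 0")
  case False
  assume v: "v \<in> pverts G"
  with False card_units obtain t where "t \<in> units v" by fastforce
  then show ?thesis using v s_le_units units_less_f by fastforce
qed (use zero_exec in simp)

lemma f_le_s: "(u, v) \<in> (parcs G)\<^sup>+ \<Longrightarrow> f u \<le> s v"
proof (induction rule: trancl_induct)
  case (step v w)
  then show ?case using precedence s_le_f[of v] arc_verts by (meson order_trans)
qed (rule precedence)

lemma f_mono: "(u, v) \<in> (parcs G)\<^sup>* \<Longrightarrow> v \<in> pverts G \<Longrightarrow> f u \<le> f v"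
  using f_le_s s_le_f by (metis order_refl order_trans rtrancl_eq_or_trancl)

lemma f_le_resp: "v \<in> pverts G \<Longrightarrow> f v \<le> resp"
  unfolding resp_def using f_mono reach_v_snk v_snk by (auto simp: is_sink_def)

lemma units_ordered:
  assumes "(u, v) \<in> (parcs G)\<^sup>+" "v \<in> pverts G" "t \<in> units u" "t' \<in> units v"
  shows "t < t'"
proof -
  have "u \<in> pverts G" using assms reach_verts trancl_into_rtrancl by metis
  then show ?thesis
    using units_less_f[of u t] f_le_s[OF assms(1)] s_le_units[of v t'] assms by simp
qed

text \<open>Of two distinct comparable vertices, one executes entirely before the other.\<close>

lemma chain_units_unique:
  assumes "dag_chain S" "u \<in> S" "v \<in> S" "t \<in> units u" "t \<in> units v"
  shows "u = v"
proof -
  have "u \<in> pverts G" "v \<in> pverts G"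
    and "u = v \<or> (u, v) \<in> (parcs G)\<^sup>+ \<or> (v, u) \<in> (parcs G)\<^sup>+"
    using assms by (auto simp: dag_chain_def rtrancl_eq_or_trancl)
  then show ?thesis using assms units_ordered by blast
qed

lemma finite_occ: "dag_chain S \<Longrightarrow> finite (occ S)"
  using finite_dag_chain finite_units by (auto simp: occ_def dag_chain_def)

text \<open>Within a chain no unit is shared, so counting time units counts pieces of
  execution.\<close>

lemma card_occ:
  assumes "dag_chain S"
  shows "card (occ S) = (\<Sum>v\<in>S. e v)"
proof -
  have S: "v \<in> S \<Longrightarrow> v \<in> pverts G" for v using assms by (auto simp: dag_chain_def)
  have "card (occ S) = (\<Sum>v\<in>S. card (units v))"
    unfolding occ_def using finite_dag_chain[OF assms] finite_units S chain_units_unique[OF assms]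
    by (intro card_UN_disjoint) auto
  then show ?thesis using card_units S by simp
qed

section \<open>The height and its descent\<close>

lemma finite_dag_chains: "finite {S. dag_chain S}"
  by (rule finite_subset[of _ "Pow (pverts G)"]) (auto simp: dag_chain_def pair_finite_verts)

lemma card_occ_le_height: "dag_chain S \<Longrightarrow> card (occ S \<inter> {t..}) \<le> height t"
  unfolding height_def using finite_dag_chains by (intro Max_ge) auto

lemma height_attained:
  obtains S where "dag_chain S" "card (occ S \<inter> {t..}) = height t"
proof -
  have "height t \<in> (\<lambda>S. card (occ S \<inter> {t..})) ` {S. dag_chain S}"
    unfolding height_def using finite_dag_chains dag_chain_empty
    by (intro Max_in finite_imageI) blast+
  then show ?thesis using that by auto
qed

lemma height_0: "height 0 \<le> len G c"
proof -
  obtain S where S: "dag_chain S" "card (occ S \<inter> {0..}) = height 0" by (rule height_attained)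
  then have "height 0 = (\<Sum>v\<in>S. e v)" using card_occ[OF S(1)] by (simp add: atLeast_0)
  also have "\<dots> \<le> (\<Sum>v\<in>S. c v)"
    using S(1) exec_le_wcet by (intro sum_mono) (auto simp: dag_chain_def)
  also have "\<dots> \<le> len G c" using S(1) by (rule dag_chain_sum_le_len)
  finally show ?thesis .
qed

lemma height_resp: "height resp = 0"
proof -
  obtain S where S: "dag_chain S" "card (occ S \<inter> {resp..}) = height resp" by (rule height_attained)
  then have "occ S \<inter> {resp..} = {}"
    using units_less_f f_le_resp by (fastforce simp: occ_def dag_chain_def)
  then show ?thesis using S by simp
qed

lemma height_Suc_le: "height (Suc t) \<le> height t"
proof -
  obtain S where S: "dag_chain S" "card (occ S \<inter> {Suc t..}) = height (Suc t)" by (rule height_attained)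
  have "card (occ S \<inter> {Suc t..}) \<le> card (occ S \<inter> {t..})"
    using finite_occ[OF S(1)] by (intro card_mono) auto
  then show ?thesis using S card_occ_le_height[OF S(1), of t] by simp
qed

text \<open>A chain receives at most one piece of execution per time unit, so discarding the unit
  \<open>t\<close> costs at most one.\<close>

lemma height_le_Suc: "height t \<le> Suc (height (Suc t))"
proof -
  obtain S where S: "dag_chain S" "card (occ S \<inter> {t..}) = height t" by (rule height_attained)
  have "card (occ S \<inter> {t..}) \<le> card (insert t (occ S \<inter> {Suc t..}))"
    using finite_occ[OF S(1)] by (intro card_mono) auto
  also have "\<dots> \<le> Suc (card (occ S \<inter> {Suc t..}))"
    using finite_occ[OF S(1)] by (intro card_insert_le_m1) auto
  finally show ?thesis using S card_occ_le_height[OF S(1), of "Suc t"] by simp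
qed

text \<open>Telescoping from \<open>height resp = 0\<close>: each unit outside
  \<open>stalled\<close> lowers the height by exactly one.\<close>

lemma height_eq:
  assumes "t \<le> resp"
  shows "height t = card ({t..<resp} - stalled)"
  using assms
proof (induction t rule: inc_induct)
  case base
  then show ?case by (simp add: height_resp)
next
  case (step t)
  have "{t..<resp} - stalled = (if t \<in> stalled then {} else {t}) \<union> ({Suc t..<resp} - stalled)"
    using step by (auto simp: Suc_le_eq le_less)
  then have "card ({t..<resp} - stalled) =
      (if t \<in> stalled then 0 else 1) + card ({Suc t..<resp} - stalled)"
    by simp
  then show ?case
    using step height_Suc_le[of t] height_le_Suc[of t] by (auto simp: stalled_def)
qed

text \<open>In a time unit with an idle core, every unfinished vertex all of whose predecessors are
  finished executes; such a vertex exists below any given unfinished one, so it can be added to a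
  chain attaining \<open>height (Suc t)\<close>.\<close>

lemma idle_imp_height_less:
  assumes "t < resp" "p < m" "run t p = None"
  shows "height (Suc t) < height t"
proof -
  obtain S where S: "dag_chain S" "card (occ S \<inter> {Suc t..}) = height (Suc t)" by (rule height_attained)
  define U where "U = {v \<in> S. t < f v}"
  have sink: "v_snk G \<in> pverts G" using v_snk by (auto simp: is_sink_def)
  have U: "dag_chain U" using S(1) by (rule dag_chain_subset) (auto simp: U_def)
  \<comment> \<open>Adding the sink makes the chain nonempty. The sink is unfinished because
    \<open>t < resp\<close>, so the least vertex \<open>w\<close> is unfinished in every
    case.\<close>
  have "dag_chain (insert (v_snk G) U)"
    using U sink reach_v_snk by (auto simp: dag_chain_def)
  then obtain w where w: "w \<in> insert (v_snk G) U"
    "\<And>x. x \<in> insert (v_snk G) U \<Longrightarrow> (w, x) \<in> (parcs G)\<^sup>*"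
    using dag_chain_least by (metis insert_not_empty)
  have wV: "w \<in> pverts G" and wf: "t < f w"
    using w(1) sink U assms(1) by (auto simp: dag_chain_def U_def resp_def)
  have "w \<in> {x. t < f x \<and> (x, w) \<in> (parcs G)\<^sup>*}" using wf by simp
  then obtain u where u: "u \<in> {x. t < f x \<and> (x, w) \<in> (parcs G)\<^sup>*}"
    and min: "\<And>y. (y, u) \<in> parcs G \<Longrightarrow> y \<notin> {x. t < f x \<and> (x, w) \<in> (parcs G)\<^sup>*}"
    by (rule wfE_min[OF wf_parcs]) blast
  then have u: "t < f u" "(u, w) \<in> (parcs G)\<^sup>*" by auto
  have uV: "u \<in> pverts G" using u(2) wV by (rule reach_verts)
  have "f y \<le> t" if "y \<in> pre G u" for y
    using min[of y] that u(2) by (auto simp: pre_def intro: converse_rtrancl_into_rtrancl)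
  then have ut: "t \<in> units u"
    using work_cons uV u(1) assms(2,3) unfolding work_conserving_def by (metis Suc_eq_plus1 Suc_leI)
  have "(u, x) \<in> (parcs G)\<^sup>*" if "x \<in> U" for x
    using u(2) w(2)[of x] that by (meson insertI2 rtrancl_trans)
  then have S': "dag_chain (insert u U)"
    using U uV by (auto simp: dag_chain_def)
  \<comment> \<open>A vertex finished by \<open>t\<close> has no later units, so passing from
    \<open>S\<close> to \<open>U\<close> loses nothing.\<close>
  have "x \<in> U" if "x \<in> S" "i \<in> units x" "Suc t \<le> i" for x i
    using that S(1) units_less_f[of x i] by (auto simp: U_def dag_chain_def)
  then have "insert t (occ S \<inter> {Suc t..}) \<subseteq> occ (insert u U) \<inter> {t..}"
    using ut by (fastforce simp: occ_def)
  then have "card (insert t (occ S \<inter> {Suc t..})) \<le> card (occ (insert u U) \<inter> {t..})"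
    using finite_occ[OF S'] by (intro card_mono) auto
  moreover have "card (insert t (occ S \<inter> {Suc t..})) = Suc (height (Suc t))"
    using finite_occ[OF S(1)] S(2) by simp
  ultimately show ?thesis using card_occ_le_height[OF S', of t] by simp
qed

lemma all_busy:
  assumes "t \<in> stalled" "p < m"
  shows "run t p \<noteq> None"
  using assms idle_imp_height_less[of t p] by (auto simp: stalled_def)

text \<open>The vertex \<open>y\<close> is taken on a chain attaining \<open>height t\<close>; the part up to \<open>y\<close> of any other chain
  through \<open>y\<close> can be continued by the part of that chain from \<open>y\<close> on.\<close>

lemma bottleneck_vertex_exists:
  assumes "t < resp" "t \<notin> stalled"
  shows "\<exists>y\<in>pverts G. t \<in> units y \<and> (\<forall>S t\<^sub>0. dag_chain S \<longrightarrow> y \<in> S \<longrightarrow> t\<^sub>0 \<le> t \<longrightarrow>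
           card (occ S \<inter> {t\<^sub>0..t}) + height t \<le> Suc (height t\<^sub>0))"
proof -
  obtain P where P: "dag_chain P" "card (occ P \<inter> {t..}) = height t" by (rule height_attained)
  have "height (Suc t) < height t"
    using assms height_Suc_le[of t] by (auto simp: stalled_def)
  \<comment> \<open>If \<open>P\<close> did not execute in \<open>t\<close>, it would still receive
    \<open>height t\<close> from \<open>Suc t\<close> on, and the height could not fall.\<close>
  moreover have "occ P \<inter> {t..} = occ P \<inter> {Suc t..}" if "t \<notin> occ P"
    using that by (auto simp: Suc_le_eq le_less)
  ultimately have "t \<in> occ P"
    using P card_occ_le_height[OF P(1), of "Suc t"] by fastforce
  then obtain y where y: "y \<in> P" "t \<in> units y" by (auto simp: occ_def)
  have "card (occ S \<inter> {t\<^sub>0..t}) + height t \<le> Suc (height t\<^sub>0)"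
    if S: "dag_chain S" "y \<in> S" "t\<^sub>0 \<le> t" for S t\<^sub>0
  proof -
    define S' where "S' = {x \<in> S. (x, y) \<in> (parcs G)\<^sup>*} \<union> {x \<in> P. (y, x) \<in> (parcs G)\<^sup>*}"
    have S': "dag_chain S'"
      using S(1) P(1) unfolding dag_chain_def S'_def by (auto intro: rtrancl_trans)
    have 1: "occ S \<inter> {t\<^sub>0..t} \<subseteq> occ S' \<inter> {t\<^sub>0..}"
    proof
      fix i assume "i \<in> occ S \<inter> {t\<^sub>0..t}"
      then obtain x where x: "x \<in> S" "i \<in> units x" "t\<^sub>0 \<le> i" "i \<le> t" by (auto simp: occ_def)
      have "(y, x) \<notin> (parcs G)\<^sup>+"
        using units_ordered[of y x t i] x y S(1) by (auto simp: dag_chain_def)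
      then have "x \<in> S'"
        using S x by (auto simp: S'_def dag_chain_def rtrancl_eq_or_trancl)
      then show "i \<in> occ S' \<inter> {t\<^sub>0..}" using x by (auto simp: occ_def)
    qed
    have 2: "occ P \<inter> {t..} \<subseteq> occ S' \<inter> {t\<^sub>0..}"
    proof
      fix i assume "i \<in> occ P \<inter> {t..}"
      then obtain x where x: "x \<in> P" "i \<in> units x" "t \<le> i" by (auto simp: occ_def)
      have "(x, y) \<notin> (parcs G)\<^sup>+"
        using units_ordered[of x y i t] x y P(1) by (auto simp: dag_chain_def)
      then have "x \<in> S'"
        using P(1) x y by (auto simp: S'_def dag_chain_def rtrancl_eq_or_trancl)
      then show "i \<in> occ S' \<inter> {t\<^sub>0..}" using x S(3) by (auto simp: occ_def)
    qed
    \<comment> \<open>The two sets of units meet at most in \<open>t\<close>; this overlap is the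
      \<open>Suc\<close> in the bound.\<close>
    have "card (occ S \<inter> {t\<^sub>0..t}) + card (occ P \<inter> {t..}) =
        card ((occ S \<inter> {t\<^sub>0..t}) \<union> (occ P \<inter> {t..})) + card ((occ S \<inter> {t\<^sub>0..t}) \<inter> (occ P \<inter> {t..}))"
      using finite_occ S(1) P(1) by (intro card_Un_Int) auto
    also have "\<dots> \<le> card (occ S' \<inter> {t\<^sub>0..}) + card {t}"
      using 1 2 finite_occ[OF S'] by (intro add_mono card_mono) auto
    finally show ?thesis using P(2) card_occ_le_height[OF S', of t\<^sub>0] by simp
  qed
  then show ?thesis using y P(1) by (auto simp: dag_chain_def)
qed

lemma resp_eq: "resp = height 0 + card stalled"
proof -
  have "stalled \<subseteq> {..<resp}" by (auto simp: stalled_def)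
  then have "card ({..<resp} - stalled) + card stalled = resp"
    by (metis card_Diff_subset card_lessThan card_mono finite_lessThan finite_subset
        le_add_diff_inverse2)
  then show ?thesis using height_eq[of 0] by (simp add: atLeast0LessThan)
qed

section \<open>Counting pieces of execution\<close>

definition picked :: "nat set \<Rightarrow> (nat \<Rightarrow> 'a) \<Rightarrow> (nat \<times> 'a) set" where
  "picked Q y = {(t, v). v \<in> pverts G \<and> t \<in> units v \<and> (t \<in> stalled \<or> t \<in> Q \<and> v = y t)}"

lemma finite_units_of: "W \<subseteq> pverts G \<Longrightarrow> finite (SIGMA v:W. units v)"
  using finite_subset[OF _ pair_finite_verts] finite_units by (intro finite_SigmaI) auto

lemma finite_picked: "finite (picked Q y)"
proof -
  have "picked Q y \<subseteq> prod.swap ` (SIGMA v:pverts G. units v)"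
    by (auto simp: picked_def)
  then show ?thesis using finite_units_of[of "pverts G"] finite_subset by blast
qed

text \<open>All cores are busy in a stalled unit and no vertex occupies two of them, so such a unit
  carries at least \<open>m\<close> pieces. Each unit of \<open>Q\<close> adds the piece of
  \<open>y t\<close>.\<close>

lemma card_picked:
  assumes Q: "Q \<subseteq> {..<resp} - stalled" and y: "\<And>t. t \<in> Q \<Longrightarrow> y t \<in> pverts G \<and> t \<in> units (y t)"
  shows "m * card stalled + card Q \<le> card (picked Q y)"
proof -
  define A where "A t = {v \<in> pverts G. t \<in> units v}" for t
  have fin: "finite stalled" "finite Q" "finite (A t)" for t
    using Q pair_finite_verts by (auto simp: stalled_def A_def intro: finite_subset)
  have "m \<le> card (A t)" if t: "t \<in> stalled" for t
  proof -
    have busy: "p < m \<Longrightarrow> \<exists>v. run t p = Some v" for p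
      using all_busy[OF t] by auto
    have "card ((\<lambda>p. the (run t p)) ` {..<m}) = card {..<m}"
    proof (rule card_image, rule inj_onI)
      fix p q assume "p \<in> {..<m}" "q \<in> {..<m}" "the (run t p) = the (run t q)"
      then show "p = q" using busy[of p] busy[of q] one_core by auto
    qed
    moreover have "(\<lambda>p. the (run t p)) ` {..<m} \<subseteq> A t"
      using busy run_verts by (force simp: A_def exec_units_def)
    ultimately show ?thesis using fin card_mono by (metis card_lessThan)
  qed
  then have "m * card stalled \<le> (\<Sum>t\<in>stalled. card (A t))"
    using sum_mono[of stalled "\<lambda>_. m" "\<lambda>t. card (A t)"] by (simp add: mult.commute)
  also have "\<dots> = card (SIGMA t:stalled. A t)"
    using fin by simp
  finally have "m * card stalled + card Q \<le> card (SIGMA t:stalled. A t) + card ((\<lambda>t. (t, y t)) ` Q)"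
    by (simp add: card_image inj_on_def)
  also have "\<dots> = card ((SIGMA t:stalled. A t) \<union> (\<lambda>t. (t, y t)) ` Q)"
    using fin Q by (intro card_Un_disjoint[symmetric]) auto
  also have "\<dots> \<le> card (picked Q y)"
    using finite_picked y by (intro card_mono) (auto simp: picked_def A_def)
  finally show ?thesis .
qed

text \<open>A picked piece belongs to an uncovered vertex, and these carry at most the sum of
  \<open>e\<close>, or to one of the \<open>n\<close> chains, each carrying at most
  \<open>B\<close>.\<close>

lemma picked_cover_bound:
  assumes Q: "Q \<subseteq> {..<resp} - stalled" and y: "\<And>t. t \<in> Q \<Longrightarrow> y t \<in> pverts G \<and> t \<in> units (y t)"
    and S: "\<And>i. i < n \<Longrightarrow> dag_chain (S i)"
    and B: "\<And>i. i < n \<Longrightarrow> card (fst ` {p \<in> picked Q y. snd p \<in> S i}) \<le> B"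
  shows "m * card stalled + card Q \<le> (\<Sum>v\<in>pverts G - (\<Union>i<n. S i). e v) + n * B"
proof -
  define W where "W = pverts G - (\<Union>i<n. S i)"
  have fin: "finite {p \<in> picked Q y. snd p \<in> S i}" for i
    using finite_picked by (rule rev_finite_subset) auto
  have bound: "card {p \<in> picked Q y. snd p \<in> S i} \<le> B" if i: "i < n" for i
  proof -
    \<comment> \<open>On a chain the time unit determines the vertex, so pieces may be counted by
      their times.\<close>
    have "inj_on fst {p \<in> picked Q y. snd p \<in> S i}"
      using chain_units_unique[OF S[OF i]] by (auto simp: inj_on_def picked_def)
    then show ?thesis using B[OF i] by (simp add: card_image)
  qed
  have "picked Q y \<subseteq> prod.swap ` (SIGMA v:W. units v) \<union> (\<Union>i<n. {p \<in> picked Q y. snd p \<in> S i})"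
    by (auto simp: picked_def W_def image_iff)
  then have "card (picked Q y) \<le>
      card (prod.swap ` (SIGMA v:W. units v) \<union> (\<Union>i<n. {p \<in> picked Q y. snd p \<in> S i}))"
    using fin finite_units_of[of W] by (intro card_mono) (auto simp: W_def)
  also have "\<dots> \<le> card (SIGMA v:W. units v) + (\<Sum>i<n. card {p \<in> picked Q y. snd p \<in> S i})"
    using finite_units_of[of W]
    by (intro card_Un_le[THEN order_trans] add_mono card_UN_le card_image_le) (auto simp: W_def)
  also have "card (SIGMA v:W. units v) = (\<Sum>v\<in>W. e v)"
    using card_units finite_units pair_finite_verts by (simp add: W_def)
  also have "(\<Sum>i<n. card {p \<in> picked Q y. snd p \<in> S i}) \<le> n * B"
    using sum_mono[of "{..<n}" "\<lambda>i. card {p \<in> picked Q y. snd p \<in> S i}" "\<lambda>_. B"] bound by simp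
  finally show ?thesis
    using card_picked[OF Q y] by (simp add: W_def)
qed

text \<open>Stated without subtraction, since nothing forces \<open>n \<le> m + 1\<close>
  here.\<close>

lemma chain_cover_bound:
  assumes S: "\<And>i. i < n \<Longrightarrow> dag_chain (S i)" and "n > 0"
  shows "(m + 1) * card stalled \<le> (\<Sum>v\<in>pverts G - (\<Union>i<n. S i). e v) + n * card stalled"
proof -
  have ZR: "stalled \<subseteq> {..<resp}" by (auto simp: stalled_def)
  have H0: "card ({..<resp} - stalled) = height 0"
    using height_eq[of 0] by (simp add: atLeast0LessThan)
  obtain y where y: "\<And>t. t \<in> {..<resp} - stalled \<Longrightarrow> y t \<in> pverts G \<and> t \<in> units (y t) \<and>
      (\<forall>S t\<^sub>0. dag_chain S \<longrightarrow> y t \<in> S \<longrightarrow> t\<^sub>0 \<le> t \<longrightarrow>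
        card (occ S \<inter> {t\<^sub>0..t}) + height t \<le> Suc (height t\<^sub>0))"
    using bottleneck_vertex_exists by (metis Diff_iff lessThan_iff)
  show ?thesis
  proof (cases "card stalled \<le> height 0")
    case True
    then obtain Q where Q: "Q \<subseteq> {..<resp} - stalled" "card stalled \<le> card Q"
      and few: "\<And>T. \<lbrakk>T \<subseteq> stalled \<union> Q;
           \<And>t. t \<le> resp \<Longrightarrow> card (T \<inter> {t..}) \<le> card ({t..<resp} - stalled);
           \<And>t t\<^sub>0. \<lbrakk>t \<in> T - stalled; t\<^sub>0 \<le> t\<rbrakk> \<Longrightarrow>
             card (T \<inter> {t\<^sub>0..t}) \<le> card ({t\<^sub>0..<Suc t} - stalled)\<rbrakk>
           \<Longrightarrow> card T \<le> card stalled"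
      using balanced_choice_exists[OF ZR] H0 by metis
    have "card (fst ` {p \<in> picked Q y. snd p \<in> S i}) \<le> card stalled" if i: "i < n" for i
    proof (rule few)
      let ?T = "fst ` {p \<in> picked Q y. snd p \<in> S i}"
      have T: "?T \<subseteq> occ (S i)" and fin: "finite (occ (S i))"
        using finite_occ[OF S[OF i]] by (auto simp: picked_def occ_def)
      show "?T \<subseteq> stalled \<union> Q" by (auto simp: picked_def)
      show "card (?T \<inter> {t..}) \<le> card ({t..<resp} - stalled)" if "t \<le> resp" for t
      proof -
        have "card (?T \<inter> {t..}) \<le> card (occ (S i) \<inter> {t..})"
          using T fin by (intro card_mono) auto
        then show ?thesis using card_occ_le_height[OF S[OF i], of t] height_eq[OF that] by simp
      qed
      show "card (?T \<inter> {t\<^sub>0..t}) \<le> card ({t\<^sub>0..<Suc t} - stalled)"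
        if t: "t \<in> ?T - stalled" "t\<^sub>0 \<le> t" for t t\<^sub>0
      proof -
        \<comment> \<open>A unit of \<open>?T\<close> that is not stalled was picked for
          \<open>y t\<close>, so \<open>S i\<close> contains this bottleneck vertex. Hence
          \<open>S i\<close> has at most one unit more in the window than the height drops from
          \<open>t\<^sub>0\<close> to \<open>t\<close>; the step unit \<open>t\<close> itself makes
          up for that one.\<close>
        have "y t \<in> S i" "t \<in> Q" using t by (auto simp: picked_def)
        then have "card (occ (S i) \<inter> {t\<^sub>0..t}) + height t \<le> Suc (height t\<^sub>0)"
            and tR: "t < resp" and tZ: "t \<notin> stalled"
          using y[of t] S[OF i] t(2) Q(1) by auto
        moreover have "card (?T \<inter> {t\<^sub>0..t}) \<le> card (occ (S i) \<inter> {t\<^sub>0..t})"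
          using T fin by (intro card_mono) auto
        moreover have "height t\<^sub>0 + card ({..<t\<^sub>0} - stalled) = card ({..<resp} - stalled)"
          using card_Diff_atLeastLessThan[of t\<^sub>0 resp stalled] height_eq[of t\<^sub>0] tR t(2) by simp
        moreover have "Suc (height t + card ({..<t} - stalled)) = Suc (card ({..<resp} - stalled))"
          using card_Diff_atLeastLessThan[of t resp stalled] height_eq[of t] tR by simp
        moreover have "card ({..<Suc t} - stalled) = Suc (card ({..<t} - stalled))"
          using tZ by (simp add: lessThan_Suc insert_Diff_if)
        ultimately show ?thesis
          using card_Diff_atLeastLessThan[of t\<^sub>0 "Suc t" stalled] t(2) by simp
      qed
    qed
    then have "m * card stalled + card Q \<le> (\<Sum>v\<in>pverts G - (\<Union>i<n. S i). e v) + n * card stalled"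
      using Q(1) y S by (intro picked_cover_bound[where y = y]) auto
    then show ?thesis using Q(2) by simp
  next
    case False
    \<comment> \<open>Here all step units are chosen and a chain has at most \<open>height 0\<close>
      pieces. The share of one chain cancels against the \<open>height 0\<close> added pieces; the
      other shares only grow when \<open>height 0\<close> is replaced by \<pi>.\<close>
    have "card (fst ` {p \<in> picked ({..<resp} - stalled) y. snd p \<in> S i}) \<le> height 0" if i: "i < n" for i
    proof -
      have "card (fst ` {p \<in> picked ({..<resp} - stalled) y. snd p \<in> S i}) \<le> card (occ (S i) \<inter> {0..})"
        using finite_occ[OF S[OF i]] by (intro card_mono) (auto simp: picked_def occ_def)
      then show ?thesis using card_occ_le_height[OF S[OF i], of 0] by simp
    qed
    then have "m * card stalled + height 0 \<le> (\<Sum>v\<in>pverts G - (\<Union>i<n. S i). e v) + n * height 0"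
      using picked_cover_bound[of "{..<resp} - stalled" y n S "height 0"] y S H0 by simp
    moreover obtain k where k: "n = Suc k" using \<open>n > 0\<close> by (cases n) auto
    moreover have "k * height 0 \<le> k * card stalled" using False by (intro mult_le_mono2) simp
    ultimately show ?thesis unfolding k mult_Suc add_mult_distrib mult_1 by linarith
  qed
qed

end

section \<open>The greedy path list\<close>

lemma seq_len_cong: "(\<And>v. v \<in> set l \<Longrightarrow> c v = c' v) \<Longrightarrow> seq_len c l = seq_len c' l"
  by (simp add: seq_len_def cong: map_cong)

context task_dag
begin

text \<open>Removed vertices have WCET \<open>0\<close> in the residue, so the clause on nonzero
  WCETs, applied to the residue, separates later paths from earlier ones.\<close>

lemma greedy_paths_dag_chain:
  assumes "greedy_paths G c ls" "l \<in> set ls"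
  shows "dag_chain (set l) \<and> distinct l \<and> (\<forall>v\<in>set l. c v \<noteq> 0)"
  using assms
proof (induction rule: greedy_paths.induct)
  case (step c p l' ls)
  then have p: "complete_path G p" by (simp add: longest_path_def)
  then have "dag_chain (set l')" "distinct l'"
    using complete_path_dag_chain[OF p] step.hyps(3)
    by (auto simp: complete_path_def vpath_def elim: dag_chain_subset)
  moreover have "\<forall>v\<in>set l'. c v \<noteq> 0"
    using step.hyps(3) by simp
  moreover have "residue c (set l') v \<noteq> 0 \<Longrightarrow> c v \<noteq> 0" for v
    by (simp add: residue_def split: if_splits)
  ultimately show ?case
    using step.IH step.prems by (metis set_ConsD)
qed simp

text \<open>The paths are disjoint, and on the later ones the residue agrees with
  \<open>c\<close>.\<close>

lemma greedy_paths_sum: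
  assumes "greedy_paths G c ls" "n \<le> length ls"
  shows "(\<Sum>i<n. seq_len c (ls ! i)) = (\<Sum>v\<in>(\<Union>i<n. set (ls ! i)). c v)"
  using assms
proof (induction arbitrary: n rule: greedy_paths.induct)
  case (step c p l ls)
  show ?case
  proof (cases n)
    case n: (Suc k)
    let ?c = "residue c (set l)" and ?U = "\<Union>i<k. set (ls ! i)"
    have eq: "v \<notin> set l \<and> ?c v = c v" if "i < k" "v \<in> set (ls ! i)" for i v
      using greedy_paths_dag_chain[OF step.hyps(4), of "ls ! i"] that step.prems n
      by (auto simp: residue_def split: if_splits)
    have "distinct l"
      using greedy_paths_dag_chain[OF greedy_paths.step[OF step.hyps]] by simp
    then have "(\<Sum>i<n. seq_len c ((l # ls) ! i)) = (\<Sum>v\<in>set l. c v) + (\<Sum>i<k. seq_len ?c (ls ! i))"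
      using eq seq_len_cong[of _ c ?c]
      by (simp add: n lessThan_Suc_eq_insert_0 sum.reindex seq_len_distinct)
    also have "(\<Sum>i<k. seq_len ?c (ls ! i)) = (\<Sum>v\<in>?U. ?c v)"
      using step.IH step.prems n by simp
    also have "\<dots> = (\<Sum>v\<in>?U. c v)"
      using eq by (intro sum.cong) auto
    also have "(\<Sum>v\<in>set l. c v) + (\<Sum>v\<in>?U. c v) = (\<Sum>v\<in>set l \<union> ?U. c v)"
      using eq by (intro sum.union_disjoint[symmetric]) auto
    also have "set l \<union> ?U = (\<Union>i<n. set ((l # ls) ! i))"
      by (auto simp: n lessThan_Suc_eq_insert_0)
    finally show ?thesis .
  qed simp
qed simp

text \<open>The sum is the volume of the residue graph after \<open>n\<close> rounds, and the loop
  stops exactly when this volume is \<open>0\<close>.\<close>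

lemma greedy_paths_rest_eq_0_iff:
  assumes "greedy_paths G c ls" "n \<le> length ls"
  shows "(\<Sum>v\<in>pverts G - (\<Union>i<n. set (ls ! i)). c v) = 0 \<longleftrightarrow> n = length ls"
  using assms
proof (induction arbitrary: n rule: greedy_paths.induct)
  case (stop c)
  then show ?case by (simp add: vol_def)
next
  case (step c p l ls)
  show ?case
  proof (cases n)
    case 0
    then show ?thesis using step.hyps(1) by (simp add: vol_def)
  next
    case n: (Suc k)
    let ?U = "\<Union>i<k. set (ls ! i)"
    have "(\<Union>i<n. set ((l # ls) ! i)) = set l \<union> ?U"
      by (auto simp: n lessThan_Suc_eq_insert_0)
    then have "(\<Sum>v\<in>pverts G - (\<Union>i<n. set ((l # ls) ! i)). c v) =
        (\<Sum>v\<in>pverts G - ?U. residue c (set l) v)"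
      using pair_finite_verts by (intro sum.mono_neutral_cong_left) (auto simp: residue_def)
    then show ?thesis using step.IH[of k] step.prems n by simp
  qed
qed

end

section \<open>From the chain bound to the number of cores\<close>

theorem theorem3:
  fixes G :: "'a pair_pre_digraph" and c :: "'a \<Rightarrow> nat" and \<Lambda> :: "'a list list"
    and C L m :: nat and Ls :: "nat list" and D T :: real
  assumes "task_dag G"
    and "vol G c > 0"
    and "greedy_paths G c \<Lambda>"
    and "C = vol G c"
    and "Ls = map (seq_len c) \<Lambda>"
    and "L = len G c"
    and "real C \<ge> D" and "D \<ge> real L"
    and "D \<le> T"
    and "m = Min (m_of C Ls L D ` m_dom Ls L D)"
  shows "schedulable G c D m"
  unfolding schedulable_def
proof (intro allI impI, elim conjE)
  fix run e s f
  assume ex: "execution_sequence G c m run e s f" and wc: "work_conserving G m run f"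
  interpret task_dag G by fact
  interpret dag_execution G c m run e s f
    using \<open>task_dag G\<close> ex wc by (simp add: dag_execution_def dag_execution_axioms_def)
  define k where "k = length Ls - 1"
  have "\<Lambda> \<noteq> []"
    using assms(2,3) by (auto elim: greedy_paths.cases)
  then have k: "length \<Lambda> = Suc k"
    using assms(5) by (cases \<Lambda>) (auto simp: k_def)
  have dom: "m_dom Ls L D = {j. j < k \<and> D > real L \<or> j = k}"
    by (simp add: m_dom_def k_def Let_def)
  then have "finite (m_dom Ls L D)" "m_dom Ls L D \<noteq> {}"
    by (auto intro: finite_subset[of _ "{..k}"])
  \<comment> \<open>It suffices to argue with one index \<open>j\<close> at which the minimum is
    attained.\<close>
  then have "m \<in> m_of C Ls L D ` m_dom Ls L D"
    unfolding assms(10) by (intro Min_in) auto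
  then obtain j where "j \<in> m_dom Ls L D" and jm: "m = m_of C Ls L D j"
    by blast
  then have j: "j \<le> k" "j < k \<longrightarrow> D > real L"
    unfolding dom by auto
  define U W where "U = (\<Union>i<Suc j. set (\<Lambda> ! i))" and "W = (\<Sum>v\<in>pverts G - U. c v)"
  have chain: "dag_chain (set (\<Lambda> ! i))" if "i < Suc j" for i
    using greedy_paths_dag_chain[OF assms(3)] that j(1) k by auto
  then have UV: "U \<subseteq> pverts G"
    by (auto simp: U_def dag_chain_def)
  \<comment> \<open>The uncovered volume vanishes exactly at the last index, which matches the two
    cases of \<open>m_of\<close>.\<close>
  have W0: "W = 0 \<longleftrightarrow> j = k"
    using greedy_paths_rest_eq_0_iff[OF assms(3), of "Suc j"] j(1) k by (simp add: U_def W_def)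
  have "C = W + (\<Sum>v\<in>U. c v)"
    unfolding assms(4) vol_def W_def using UV pair_finite_verts by (rule sum.subset_diff)
  also have "(\<Sum>v\<in>U. c v) = (\<Sum>i<Suc j. seq_len c (\<Lambda> ! i))"
    using greedy_paths_sum[OF assms(3), of "Suc j"] j(1) k by (simp add: U_def)
  also have "\<dots> = (\<Sum>i=0..j. Ls ! i)"
    using j(1) k by (intro sum.cong) (auto simp: assms(5))
  finally have W: "real W = real C - (\<Sum>i=0..j. real (Ls ! i))"
    by simp
  have "(m + 1) * card stalled \<le> (\<Sum>v\<in>pverts G - U. e v) + Suc j * card stalled"
    unfolding U_def using chain by (intro chain_cover_bound) auto
  also have "(\<Sum>v\<in>pverts G - U. e v) \<le> W"
    unfolding W_def using exec_le_wcet by (intro sum_mono) auto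
  \<comment> \<open>The extra \<open>1\<close> in \<open>m + 1\<close> cancels one of the
    \<open>j + 1\<close> chains: this is the gain from the additional pieces.\<close>
  finally have main: "m * card stalled \<le> W + j * card stalled" by simp
  have resp: "real (f (v_snk G)) \<le> real L + real (card stalled)"
    using resp_eq height_0 assms(6) by (simp add: resp_def)
  show "real (f (v_snk G)) \<le> D"
  proof (cases "j = k")
    case True
    \<comment> \<open>Nothing is left uncovered and \<open>m = j + 1\<close>, so not even one
      stalled unit is possible.\<close>
    then have "m = Suc j" using jm by (simp add: m_of_def k_def Let_def)
    then have "card stalled = 0" using main W0 True by simp
    then show ?thesis using resp assms(8) by simp
  next
    case False
    then have DL: "D > real L" and "j < k" using j by auto
    have "W > 0" using W0 False by simp
    have "m = nat \<lceil>real W / (D - real L)\<rceil> + j"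
      using jm \<open>j < k\<close> unfolding W by (simp add: m_of_def k_def Let_def)
    \<comment> \<open>The ceiling gives \<open>m - j \<ge> W / (D - L)\<close>; multiplying by \<pi>
      and cancelling \<open>W > 0\<close> leaves \<pi> \<le> \<open>D - L\<close>.\<close>
    then have "real m \<ge> real W / (D - real L) + real j"
      by linarith
    then have "real W / (D - real L) * real (card stalled) \<le> (real m - real j) * real (card stalled)"
      by (intro mult_right_mono) auto
    also have "\<dots> \<le> real W"
      using main by (simp add: algebra_simps flip: of_nat_mult of_nat_add)
    finally have "real W * real (card stalled) \<le> real W * (D - real L)"
      using DL by (simp add: field_simps)
    then have "real (card stalled) \<le> D - real L"
      using \<open>W > 0\<close> by simp
    then show ?thesis using resp by simp
  qed
qed

end
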